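(* Let $n_1$ and $n_2$ be two positive integers such that $$ \left\{ \begin{array}{ll} \mathrm{rad}(n_1)\mid n_2\ \text{and}\ n_2\mid n_1, & \text{if}\ v_2(n_1)\leq 1;\\ 2\,\mathrm{rad}(n_1)\mid n_2\ \text{and}\ n_2\mid n_1, & \text{if}\ v_2(n_1)\geq 2. \end{array} \right. $$ Then, for every integer $a$ coprime to $n_1$ and $n_2$, we have $$ \mathcal{O}_{n_1}(a) = \mathcal{O}_{n_2}(a)\cdot\frac{n_1}{\gcd(n_1,\mathcal{R}_{n_2}(a))}. $$
   Context: For a prime $p$ and a positive integer $n$, $v_p(n)$ is the $p$-adic valuation of $n$, and $\mathrm{rad}(n)=\prod_{p\mid n,\ p\text{ prime}}p$ is the largest square-free divisor of $n$. For an integer $a$ coprime to a positive integer $n$, $\mathcal{O}_n(a)$ is the multiplicative order of $a$ modulo $n$, i.e. the smallest positive integer $e$ with $a^e\equiv 1\pmod n$, and $\mathcal{R}_n(a)=a^{\mathcal{O}_n(a)}-1$ (an integer, multiple of $n$). Convention: $\gcd(0,n)=n$. *)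

theory Defs
  imports "HOL-Number_Theory.Number_Theory"
begin

definition rad :: "nat \<Rightarrow> nat" where
  "rad n = (\<Prod>p\<in>prime_factors n. p)"

(* The multiplicative order is ord from HOL-Number_Theory.Pocklington, used at type int
   because the base a may be zero or negative; its value is then a natural number. *)
definition ord_remainder :: "nat \<Rightarrow> int \<Rightarrow> int" where
  "ord_remainder n a = a ^ ord (int n) a - 1"

end

theory Submission
  imports Defs
begin

text \<open>
  Put \<open>b = a ^ ord n2 a\<close>. Since \<open>n2\<close> divides \<open>n1\<close>, an exponent \<open>d\<close> with \<open>n1 dvd a ^ d - 1\<close>
  is a multiple \<open>ord n2 a * k\<close>, and the question is when \<open>n1 dvd b ^ k - 1\<close>. As every prime factor
  of \<open>n1\<close> divides \<open>b - 1\<close> (and \<open>4\<close> does if it divides \<open>n1\<close>), lifting the exponent shows that this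
  is equivalent to \<open>n1 dvd k * (b - 1)\<close>, that is, to \<open>n1 div gcd n1 (b - 1) dvd k\<close>.
\<close>

section \<open>Orders of integers, and divisibility tested at prime powers\<close>

text \<open>Replacing \<open>a\<close> by its residue \<open>c\<close> changes neither coprimality
  to \<open>n\<close> nor any congruence \<open>[a ^ d = 1]\<close>, and these alone determine
  \<open>ord\<close>. This reduces the claim to natural numbers.\<close>

lemma ord_int_divides:
  fixes a :: int
  assumes "n > 0"
  shows "ord (int n) a dvd d \<longleftrightarrow> int n dvd a ^ d - 1"
proof -
  define c where "c = nat (a mod int n)"
  have c: "int c = a mod int n"
    using assms by (simp add: c_def)
  have cong: "[a ^ d = 1] (mod int n) \<longleftrightarrow> [c ^ d = 1] (mod n)" for d
  proof -
    have "[c ^ d = 1] (mod n) \<longleftrightarrow> [int c ^ d = 1] (mod int n)"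
      by (simp flip: cong_int_iff)
    thus ?thesis
      by (simp add: c cong_def power_mod)
  qed
  have "coprime (int n) a \<longleftrightarrow> coprime (int n) (int c)"
    using assms by (simp add: c)
  hence "ord (int n) a = ord n c"
    by (simp add: ord_def cong)
  thus ?thesis
    using ord_divides[of c d n] cong[of d] by (simp add: cong_iff_dvd_diff)
qed

lemma multiplicity_of_nat_int: "multiplicity (int p) (int n) = multiplicity p n"
  by (simp add: multiplicity_def flip: of_nat_power)

text \<open>Phrased with prime powers instead of an inequality of multiplicities so that
  \<open>y = 0\<close>, whose \<open>multiplicity\<close> is 0 by convention, is covered.\<close>

lemma dvd_iff_prime_power_multiplicity_dvd:
  fixes x y :: "'a :: factorial_semiring"
  assumes "x \<noteq> 0"
  shows "x dvd y \<longleftrightarrow> (\<forall>p. prime p \<longrightarrow> p ^ multiplicity p x dvd y)"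
proof (cases "y = 0")
  case False
  show ?thesis
  proof
    assume "x dvd y"
    thus "\<forall>p. prime p \<longrightarrow> p ^ multiplicity p x dvd y"
      using dvd_trans multiplicity_dvd by blast
  next
    assume *: "\<forall>p. prime p \<longrightarrow> p ^ multiplicity p x dvd y"
    show "x dvd y"
    proof (rule multiplicity_le_imp_dvd[OF assms])
      fix p :: 'a
      assume "prime p"
      with * False show "multiplicity p x \<le> multiplicity p y"
        by (intro multiplicity_geI) (auto simp: prime_def prime_elem_def)
    qed
  qed
qed auto

section \<open>Expansions of powers and geometric sums around \<open>b = 1\<close>\<close>

lemma dvd_geometric_sum_minus_length:
  fixes b :: "'a :: comm_ring_1"
  shows "b - 1 dvd (\<Sum>i<m. b ^ i) - of_nat m"
proof (induction m)
  case (Suc m)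
  have "b - 1 dvd b ^ m - 1"
    by (simp add: power_diff_1_eq)
  from dvd_add[OF Suc this] show ?case
    by (simp add: algebra_simps)
qed simp

lemma square_dvd_power_expansion:
  fixes b :: "'a :: comm_ring_1"
  shows "(b - 1)\<^sup>2 dvd b ^ m - 1 - of_nat m * (b - 1)"
proof -
  have "b ^ m - 1 - of_nat m * (b - 1) = (b - 1) * ((\<Sum>i<m. b ^ i) - of_nat m)"
    by (simp add: power_diff_1_eq algebra_simps)
  thus ?thesis
    by (simp add: power2_eq_square dvd_geometric_sum_minus_length mult_dvd_mono)
qed

text \<open>Summing the first-order expansions of the powers gives
  \<open>m + (b - 1) * m * (m - 1) / 2\<close>; doubling avoids the division in a general
  ring.\<close>

lemma square_dvd_geometric_sum_expansion:
  fixes b :: "'a :: comm_ring_1"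
  shows "(b - 1)\<^sup>2 dvd 2 * (\<Sum>i<m. b ^ i) - 2 * of_nat m - (b - 1) * of_nat m * (of_nat m - 1)"
proof (induction m)
  case (Suc m)
  have "(b - 1)\<^sup>2 dvd 2 * (b ^ m - 1 - of_nat m * (b - 1))"
    by (intro dvd_mult square_dvd_power_expansion)
  from dvd_add[OF Suc this] show ?case
    by (simp add: algebra_simps)
qed simp

section \<open>Lifting the exponent\<close>

text \<open>The sum is the factor by which \<open>b - 1\<close> grows when \<open>b\<close> becomes
  \<open>b ^ p\<close>, so each such step raises the multiplicity of \<open>p\<close> by exactly
  one.\<close>

lemma multiplicity_geometric_sum_prime:
  fixes b :: int
  assumes p: "prime p" and pb: "int p dvd b - 1" and four: "p = 2 \<Longrightarrow> 4 dvd b - 1"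
  shows "multiplicity (int p) (\<Sum>i<p. b ^ i) = 1"
proof (rule multiplicity_eqI)
  have "int p dvd (\<Sum>i<p. b ^ i) - int p"
    using dvd_geometric_sum_minus_length[of b p] pb dvd_trans by auto
  from dvd_add[OF this dvd_refl[of "int p"]]
  show "int p ^ 1 dvd (\<Sum>i<p. b ^ i)" by simp
next
  show "\<not> int p ^ Suc 1 dvd (\<Sum>i<p. b ^ i)"
  proof (cases "p = 2")
    case True
    hence "(\<Sum>i<p. b ^ i) = b + 1"
      by (simp add: numeral_2_eq_2)
    \<comment> \<open>As 4 divides \<open>b - 1\<close>, the sum \<open>b + 1\<close> is 2 modulo
      4.\<close>
    thus ?thesis
      using True four by simp presburger
  next
    case False
    hence "odd p"
      using p primes_dvd_imp_eq two_is_prime_nat by blast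
    show ?thesis
    proof
      let ?S = "\<Sum>i<p. b ^ i"
      let ?R = "(b - 1) * int p * (int p - 1)"
      assume "int p ^ Suc 1 dvd ?S"
      hence S: "(int p)\<^sup>2 dvd 2 * ?S"
        by (simp add: power2_eq_square)
      have "(int p)\<^sup>2 dvd (b - 1)\<^sup>2"
        using pb by (rule dvd_power_same)
      hence E: "(int p)\<^sup>2 dvd 2 * ?S - 2 * int p - ?R"
        using square_dvd_geometric_sum_expansion[of b p] dvd_trans by auto
      have R: "(int p)\<^sup>2 dvd ?R"
        using pb by (simp add: power2_eq_square mult_dvd_mono)
      \<comment> \<open>Everything in the doubled expansion except \<open>2 * p\<close> vanishes
        modulo the square of \<open>p\<close>, which would force \<open>p\<close> to divide
        2.\<close>
      have "2 * int p = 2 * ?S - (2 * ?S - 2 * int p - ?R) - ?R"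
        by simp
      also have "(int p)\<^sup>2 dvd \<dots>"
        by (rule dvd_diff[OF dvd_diff[OF S E] R])
      finally have "int p dvd 2"
        using p by (simp add: power2_eq_square prime_gt_0_nat)
      hence "p dvd 2"
        by presburger
      hence "p = 2"
        using p primes_dvd_imp_eq two_is_prime_nat by blast
      with \<open>p \<noteq> 2\<close> show False ..
    qed
  qed
qed

lemma multiplicity_power_minus_1:
  fixes b :: int
  assumes p: "prime p" and "int p dvd b - 1" and "p = 2 \<Longrightarrow> 4 dvd b - 1"
    and "b \<noteq> 1" and "k > 0"
  shows "b ^ k \<noteq> 1 \<and>
    multiplicity (int p) (b ^ k - 1) = multiplicity (int p) (b - 1) + multiplicity p k"
proof -
  have pp: "prime_elem (int p)"
    using p by auto
  have mult: "x \<noteq> 0 \<Longrightarrow> y \<noteq> 0 \<Longrightarrow>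
      multiplicity (int p) (x * y) = multiplicity (int p) x + multiplicity (int p) y" for x y
    by (rule prime_elem_multiplicity_mult_distrib[OF pp])
  obtain m where k: "k = p ^ multiplicity p k * m" and m: "\<not> p dvd m"
    using multiplicity_decompose'[of k p] \<open>k > 0\<close> not_prime_unit p by blast
  have *: "b ^ (p ^ s * m) \<noteq> 1 \<and>
      multiplicity (int p) (b ^ (p ^ s * m) - 1) = multiplicity (int p) (b - 1) + s" for s
    using assms(2-4)
  \<comment> \<open>The base varies because the induction step passes from \<open>b\<close> to
    \<open>b ^ p\<close>. For \<open>s = 0\<close> the cofactor of \<open>b - 1\<close> is
    \<open>m\<close> modulo \<open>p\<close>, hence prime to \<open>p\<close>.\<close>
  proof (induction s arbitrary: b)
    case 0
    let ?S = "\<Sum>i<m. b ^ i"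
    have "int p dvd ?S - int m"
      using dvd_geometric_sum_minus_length[of b m] 0(1) dvd_trans by auto
    hence S: "\<not> int p dvd ?S"
      using m dvd_diff[of "int p" ?S "?S - int m"] by auto
    hence "?S \<noteq> 0" by auto
    with S \<open>b \<noteq> 1\<close> show ?case
      using mult[of "b - 1" ?S] power_diff_1_eq[of b m]
      by (auto simp: not_dvd_imp_multiplicity_0)
  next
    case (Suc s)
    let ?S = "\<Sum>i<p. b ^ i"
    have S: "multiplicity (int p) ?S = 1"
      using multiplicity_geometric_sum_prime p Suc.prems by blast
    hence "?S \<noteq> 0" by auto
    with S \<open>b \<noteq> 1\<close> have bp: "b ^ p \<noteq> 1"
      and M: "multiplicity (int p) (b ^ p - 1) = multiplicity (int p) (b - 1) + 1"
      using mult[of "b - 1" ?S] power_diff_1_eq[of b p] by auto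
    have "b - 1 dvd b ^ p - 1"
      by (simp add: power_diff_1_eq)
    hence "int p dvd b ^ p - 1" "p = 2 \<Longrightarrow> 4 dvd b ^ p - 1"
      using Suc.prems dvd_trans by blast+
    from Suc.IH[OF this bp] M show ?case
      by (simp add: power_mult mult.assoc)
  qed
  show ?thesis
    using *[of "multiplicity p k"] k by simp
qed

text \<open>Both right-hand factors have the same multiplicity of \<open>p\<close>, unless
  \<open>b = 1\<close> or \<open>k = 0\<close>, when both are zero.\<close>

lemma prime_power_dvd_power_minus_1_iff:
  fixes b :: int
  assumes p: "prime p" and "int p dvd b - 1" and "p = 2 \<Longrightarrow> 4 dvd b - 1"
  shows "int p ^ j dvd b ^ k - 1 \<longleftrightarrow> int p ^ j dvd int k * (b - 1)"
proof (cases "b = 1 \<or> k = 0")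
  case False
  hence b: "b ^ k \<noteq> 1"
    and M: "multiplicity (int p) (b ^ k - 1) = multiplicity (int p) (b - 1) + multiplicity p k"
    using multiplicity_power_minus_1[OF assms] by auto
  have pp: "prime_elem (int p)"
    using p by auto
  have "multiplicity (int p) (int k) = multiplicity p k"
    by (rule multiplicity_of_nat_int)
  hence "multiplicity (int p) (int k * (b - 1)) = multiplicity (int p) (b ^ k - 1)"
    using False M prime_elem_multiplicity_mult_distrib[OF pp, of "int k" "b - 1"] by auto
  moreover have "\<not> is_unit (int p)"
    using p by auto
  ultimately show ?thesis
    using False b by (simp add: power_dvd_iff_le_multiplicity)
qed auto

lemma dvd_power_minus_1_iff:
  fixes b :: int
  assumes n: "n > 0"
    and rad: "\<And>p. prime p \<Longrightarrow> p dvd n \<Longrightarrow> int p dvd b - 1"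
    and four: "4 dvd n \<Longrightarrow> 4 dvd b - 1"
  shows "int n dvd b ^ k - 1 \<longleftrightarrow> int n dvd int k * (b - 1)"
proof -
  have "q ^ multiplicity q (int n) dvd b ^ k - 1 \<longleftrightarrow>
      q ^ multiplicity q (int n) dvd int k * (b - 1)" if "prime q" for q :: int
  proof -
    define p where "p = nat q"
    have q: "q = int p" and p: "prime p"
      using that prime_ge_0_int[of q] by (auto simp: p_def)
    have M: "multiplicity q (int n) = multiplicity p n"
      by (simp add: q multiplicity_of_nat_int)
    show ?thesis
    proof (cases "p dvd n")
      case False
      thus ?thesis by (simp add: M not_dvd_imp_multiplicity_0)
    next
      case True
      hence pb: "int p dvd b - 1"
        using rad p by blast
      show ?thesis
      proof (cases "p = 2 \<and> \<not> 4 dvd n")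
        case False
        thus ?thesis
          unfolding q using prime_power_dvd_power_minus_1_iff[OF p pb] four by blast
      next
        case two: True
        \<comment> \<open>Lifting may fail at 2 here, but only a single factor 2 is tested, and it
          divides \<open>b - 1\<close> and so both sides.\<close>
        have "multiplicity p n = 1"
          by (rule multiplicity_eqI) (use True two in auto)
        moreover have "b - 1 dvd b ^ k - 1"
          by (simp add: power_diff_1_eq)
        ultimately show ?thesis
          using pb M q dvd_trans by auto
      qed
    qed
  qed
  thus ?thesis
    using n by (simp add: dvd_iff_prime_power_multiplicity_dvd[of "int n"])
qed

section \<open>Radical, gcd and the order formula\<close>

lemma prime_dvd_rad:
  assumes "n > 0" "prime p" "p dvd n"
  shows "p dvd rad n"
  using assms by (auto simp: rad_def prime_factors_dvd intro!: dvd_prodI)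

text \<open>After cancelling \<open>g\<close>, the cofactors of \<open>n\<close> and
  \<open>c\<close> are coprime.\<close>

lemma dvd_mult_iff_div_gcd_dvd:
  fixes n k c :: int
  assumes "n \<noteq> 0"
  shows "n dvd k * c \<longleftrightarrow> n div gcd n c dvd k"
proof -
  define g where "g = gcd n c"
  have g: "g \<noteq> 0" "g dvd n" "g dvd c"
    using assms by (auto simp: g_def)
  have "n dvd k * c \<longleftrightarrow> g * (n div g) dvd g * (k * (c div g))"
    using g(2,3) by (simp add: mult.left_commute[of g])
  also have "\<dots> \<longleftrightarrow> n div g dvd k * (c div g)"
    unfolding dvd_mult_cancel_left using g(1) by blast
  also have "\<dots> \<longleftrightarrow> n div g dvd k"
    using div_gcd_coprime[of n c] assms by (simp add: g_def coprime_dvd_mult_left_iff)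
  finally show ?thesis by (simp add: g_def)
qed

theorem theorem2p6:
  fixes n1 n2 :: nat and a :: int
  assumes "n1 > 0" and "n2 > 0"
    and "multiplicity 2 n1 \<le> 1 \<Longrightarrow> rad n1 dvd n2 \<and> n2 dvd n1"
    and "multiplicity 2 n1 \<ge> 2 \<Longrightarrow> 2 * rad n1 dvd n2 \<and> n2 dvd n1"
    and "coprime a (int n1)" and "coprime a (int n2)"
  shows "int (ord (int n1) a) =
           int (ord (int n2) a) * (int n1 div gcd (int n1) (ord_remainder n2 a))"
proof -
  define e where "e = ord (int n2) a"
  define b where "b = a ^ e"
  define N where "N = nat (int n1 div gcd (int n1) (b - 1))"
  have N: "int N = int n1 div gcd (int n1) (b - 1)"
    by (simp add: N_def div_int_pos_iff)
  have n2: "n2 dvd n1" and rad: "rad n1 dvd n2"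
    using assms(3,4) dvd_mult_right by (cases "multiplicity 2 n1 \<le> 1"; force)+
  have nb: "int n2 dvd b - 1"
    using ord_int_divides[OF assms(2), of a e] by (simp add: b_def e_def)
  have prime_dvd: "int p dvd b - 1" if "prime p" "p dvd n1" for p
  proof -
    have "p dvd n2"
      using prime_dvd_rad[OF assms(1) that] rad by (rule dvd_trans)
    thus ?thesis
      using nb by (meson dvd_trans of_nat_dvd_iff)
  qed
  have four: "4 dvd b - 1" if "4 dvd n1"
  proof -
    \<comment> \<open>The second case of the hypothesis applies; its extra factor 2 and the one in
      \<open>rad n1\<close> together give 4.\<close>
    have "multiplicity 2 n1 \<ge> 2"
      using that assms(1) by (intro multiplicity_geI) auto
    moreover have "2 dvd rad n1"
      using that assms(1) by (intro prime_dvd_rad) auto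
    ultimately have "4 dvd n2"
      using assms(4) mult_dvd_mono[of 2 2 2 "rad n1"] by (auto intro: dvd_trans)
    hence "4 dvd int n2"
      by presburger
    thus ?thesis
      using nb by (rule dvd_trans)
  qed
  \<comment> \<open>This makes \<open>N\<close> the order of \<open>b\<close> modulo
    \<open>n1\<close>.\<close>
  have key: "int n1 dvd b ^ k - 1 \<longleftrightarrow> N dvd k" for k
  proof -
    have "int n1 dvd b ^ k - 1 \<longleftrightarrow> int n1 dvd int k * (b - 1)"
      using assms(1) prime_dvd four by (rule dvd_power_minus_1_iff)
    also have "\<dots> \<longleftrightarrow> int N dvd int k"
      using assms(1) by (simp add: dvd_mult_iff_div_gcd_dvd N)
    finally show ?thesis by simp
  qed
  \<comment> \<open>A power of \<open>a\<close> that is 1 modulo \<open>n1\<close> is also 1 modulo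
    its divisor \<open>n2\<close>.\<close>
  have e: "ord (int n1) a dvd d \<Longrightarrow> e dvd d" for d
    using assms(1,2) n2 unfolding e_def
    by (meson dvd_trans of_nat_dvd_iff ord_int_divides)
  have ord: "ord (int n1) a dvd e * k \<longleftrightarrow> N dvd k" for k
    using ord_int_divides[OF assms(1), of a "e * k"] key[of k] by (simp add: b_def power_mult)
  have "ord (int n1) a = e * N"
  proof (rule dvd_antisym)
    show "ord (int n1) a dvd e * N"
      by (simp add: ord)
    obtain k where k: "ord (int n1) a = e * k"
      using e[OF dvd_refl] by (elim dvdE)
    hence "N dvd k"
      using ord[of k] by simp
    thus "e * N dvd ord (int n1) a"
      by (simp add: k)
  qed
  thus ?thesis
    by (simp add: N ord_remainder_def b_def flip: e_def)
qed

end
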